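(* Let $\nu$ be a probability measure on $\mathbb R^n$ fulfilling approximate tensorization of entropy with constant $\kappa\ge1$, and let $X\sim\nu$. Let $$\hat F_n(x):=\frac1n\sum_{i=1}^n\mathbf 1\{X_i\le x\},\qquad \bar F(x):=\mathbb E[\hat F_n(x)]=\frac1n\sum_{i=1}^n\mathbb P(X_i\le x),\qquad x\in\mathbb R,$$ be the empirical and the average marginal cumulative distribution function, and assume that $\bar F$ is continuous. Then for any $r>0$, $$\mathbb P\left(\sup_{x\in\mathbb R}|\bar F(x)-\hat F_n(x)|\ge r\right)\le\frac4r\exp\left(-\frac{nr^2}{2\kappa}\right).$$
   Context: For a probability measure $\nu$ and $f\ge0$ with $f$ and $f|\log f|$ $\nu$-integrable, $\operatorname{Ent}_\nu(f):=\int f\log f\,d\nu-\left(\int f\,d\nu\right)\log\left(\int f\,d\nu\right)$. A probability measure $\nu$ on $\mathbb R^n$ fulfills approximate tensorization of entropy (ATE) with constant $\kappa\ge1$ if for all $f:\mathbb R^n\to[0,\infty)$ for which the quantities involved exist, with $X\sim\nu$, $$\operatorname{Ent}_\nu(f)\le\kappa\sum_{i=1}^n\mathbb E\left[\operatorname{Ent}_{\nu(\cdot\mid X_{-i})}(f)\right],$$ where $X_{-i}$ denotes all entries of $X$ except the $i$-th, $\nu(\cdot\mid X_{-i})$ is the conditional law of the $i$-th coordinate given the others, and in the $i$-th term $f$ is regarded as a function of the $i$-th coordinate with the others fixed to $X_{-i}$. *)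

theory Defs
  imports "HOL-Probability.Probability"
begin

text \<open>The convention \<open>0 log 0 = 0\<close> holds automatically, since \<open>ln 0 = 0\<close>.\<close>

definition ent :: "'a measure \<Rightarrow> ('a \<Rightarrow> real) \<Rightarrow> real" where
  "ent M f = (\<integral>x. f x * ln (f x) \<partial>M) - (\<integral>x. f x \<partial>M) * ln (\<integral>x. f x \<partial>M)"

definition ent_exists :: "'a measure \<Rightarrow> ('a \<Rightarrow> real) \<Rightarrow> bool" where
  "ent_exists M f \<longleftrightarrow> integrable M f \<and> integrable M (\<lambda>x. f x * \<bar>ln (f x)\<bar>)"

definition others :: "'n::finite \<Rightarrow> real ^ 'n \<Rightarrow> 'n \<Rightarrow> real" where
  "others i x = (\<lambda>j\<in>- {i}. x $ j)"

definition slice :: "'n::finite \<Rightarrow> real ^ 'n \<Rightarrow> (real ^ 'n \<Rightarrow> real) \<Rightarrow> real \<Rightarrow> real" where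
  "slice i x f = (\<lambda>t. f (\<chi> j. if j = i then t else x $ j))"

text \<open>\<open>K\<close> is a (regular) conditional law of the \<open>i\<close>-th coordinate given the others: a probability
  kernel such that \<open>K (X\<^sub>-\<^sub>i) A\<close> is a version of the conditional probability of \<open>X\<^sub>i \<in> A\<close>
  given the sigma-algebra generated by \<open>X\<^sub>-\<^sub>i\<close>, for every Borel set \<open>A\<close>.\<close>

definition is_cond_law ::
  "(real ^ 'n::finite) measure \<Rightarrow> 'n \<Rightarrow> (('n \<Rightarrow> real) \<Rightarrow> real measure) \<Rightarrow> bool" where
  "is_cond_law \<nu> i K \<longleftrightarrow>
     K \<in> measurable (PiM (- {i}) (\<lambda>_. borel)) (prob_algebra borel) \<and>
     (\<forall>A\<in>sets borel. AE x in \<nu>.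
        measure (K (others i x)) A =
        real_cond_exp \<nu> (vimage_algebra (space \<nu>) (others i) (PiM (- {i}) (\<lambda>_. borel)))
          (indicator {y. y $ i \<in> A}) x)"

text \<open>A probability measure on a Euclidean space always has conditional laws \<open>K i\<close>, and they are
  unique up to null sets, so the choice of version \<open>K\<close> below is immaterial. Likewise the
  premises on the conditional entropies follow from \<open>ent_exists \<nu> f\<close>; they only spell out
  that all quantities involved exist.\<close>

definition approx_tensorization :: "(real ^ 'n::finite) measure \<Rightarrow> real \<Rightarrow> bool" where
  "approx_tensorization \<nu> \<kappa> \<longleftrightarrow>
     (\<exists>K. (\<forall>i. is_cond_law \<nu> i (K i)) \<and>
       (\<forall>f. (\<forall>x. 0 \<le> f x) \<longrightarrow> ent_exists \<nu> f \<longrightarrow>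
          (\<forall>i. AE x in \<nu>. ent_exists (K i (others i x)) (slice i x f)) \<longrightarrow>
          (\<forall>i. integrable \<nu> (\<lambda>x. ent (K i (others i x)) (slice i x f))) \<longrightarrow>
          ent \<nu> f \<le> \<kappa> * (\<Sum>i\<in>UNIV. \<integral>x. ent (K i (others i x)) (slice i x f) \<partial>\<nu>)))"

definition empirical_cdf :: "real ^ 'n::finite \<Rightarrow> real \<Rightarrow> real" where
  "empirical_cdf v x = (\<Sum>i\<in>UNIV. indicator {..x} (v $ i)) / real CARD('n)"

definition avg_cdf :: "'a measure \<Rightarrow> ('a \<Rightarrow> real ^ 'n::finite) \<Rightarrow> real \<Rightarrow> real" where
  "avg_cdf M X x = (\<integral>\<omega>. empirical_cdf (X \<omega>) x \<partial>M)"

lemma avg_cdf_eq: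
  fixes X :: "'a \<Rightarrow> real ^ 'n::finite"
  assumes "prob_space M" and X: "X \<in> borel_measurable M"
  shows "avg_cdf M X x = (\<Sum>i\<in>UNIV. \<P>(\<omega> in M. X \<omega> $ i \<le> x)) / real CARD('n)"
proof -
  interpret prob_space M by fact
  have [measurable]: "(\<lambda>\<omega>. X \<omega> $ i) \<in> borel_measurable M" for i
    by (rule borel_measurable_continuous_on[OF _ X]) (intro continuous_intros)
  have *: "indicator {..x} (X \<omega> $ i) = (indicator {\<omega>. X \<omega> $ i \<le> x} \<omega> :: real)" for \<omega> i
    by (simp add: indicator_def)
  have meas: "{\<omega> \<in> space M. X \<omega> $ i \<le> x} \<in> sets M" for i
    by measurable
  have eq: "{\<omega>. X \<omega> $ i \<le> x} \<inter> space M = {\<omega> \<in> space M. X \<omega> $ i \<le> x}" for i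
    by auto
  have int: "integrable M (\<lambda>\<omega>. indicator {\<omega>. X \<omega> $ i \<le> x} \<omega> :: real)" for i
    using meas[of i] by (subst integrable_indicator_iff) (simp add: eq less_top[symmetric])
  show ?thesis
    unfolding avg_cdf_def empirical_cdf_def *
    by (simp add: Bochner_Integration.integral_sum[OF int] eq)
qed

end

theory Submission imports Defs
begin

text \<open>
  Write \<open>n\<close> for the dimension, \<open>F\<close> for the average and \<open>G\<close> for the empirical distribution function.
  The supremum is controlled by the deviations at the \<open>m\<close> quantiles of \<open>F\<close> of the levels
  \<open>j / (m + 1)\<close>, which exist because \<open>F\<close> is continuous: since \<open>F\<close> and \<open>G\<close> are monotone, the
  supremum exceeds the largest of these deviations by at most \<open>1 / (m + 1)\<close>
  (lemma \<open>deviation_le_grid\<close>). Some \<open>m \<le> 2 / r\<close> makes the spacing at most \<open>r / 2\<close>; a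
  deviation of \<open>r\<close> then forces one of \<open>r / 2\<close> at some quantile. The union bound over these
  quantiles and the two tails gives the factor \<open>2 * (2 / r)\<close>.

  At a single point \<open>s\<close>, lemma \<open>empirical_cdf_concentration\<close> bounds the probability of a deviation
  of \<open>t\<close> by \<open>2 * exp (- 2 * n * t\<^sup>2 / \<kappa>)\<close>; for \<open>t = r / 2\<close> this is the exponential of the claim. It
  is the entropy method, applied to the functions \<open>f = exp (l * G s)\<close>. Changing one
  coordinate changes \<open>G s\<close> by at most \<open>1 / n\<close>, and as a function of one coordinate \<open>f\<close> has only two
  values. So the conditional entropies are entropies of two-valued exponentials, and Hoeffding's
  lemma bounds each of them by \<open>(l / n)\<^sup>2 / 8\<close> times the conditional mean of \<open>f\<close>
  (lemma \<open>bernoulli_entropy_le\<close>). Approximate tensorization adds these up to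
  \<open>Ent f \<le> \<kappa> * l\<^sup>2 / (8 * n) * E f\<close> (lemma \<open>approx_tensorization_exp_empirical_cdf\<close>), and Herbst's
  argument integrates this inequality in \<open>l\<close> to a subgaussian bound for the moment generating
  function (lemma \<open>Herbst_argument\<close>), from which Chernoff's bound gives the tails.
\<close>

section \<open>Entropy of a two-valued exponential\<close>

text \<open>
  Hoeffding's lemma for a Bernoulli variable with success probability \<open>q\<close> and parameters \<open>h\<close> of
  either sign; negative \<open>h\<close> reduce to positive ones by exchanging success and failure.
\<close>
lemma ln_mgf_bernoulli_le:
  fixes h q :: real
  assumes "0 \<le> q" "q \<le> 1"
  shows "ln (1 + q * (exp h - 1)) - h * q \<le> h\<^sup>2 / 8"
proof (cases "h \<ge> 0")
  case True
  then show ?thesis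
    using Hoeffdings_lemma_aux[of h q] assms by simp
next
  case False
  have pos: "1 + (1 - q) * (exp (- h) - 1) > 0"
    using False assms by (intro add_pos_nonneg mult_nonneg_nonneg) auto
  have "1 + q * (exp h - 1) = exp h * (1 + (1 - q) * (exp (- h) - 1))"
    by (simp add: algebra_simps exp_minus)
  hence "ln (1 + q * (exp h - 1)) = h + ln (1 + (1 - q) * (exp (- h) - 1))"
    using pos by (simp only: ln_mult_pos[OF exp_gt_zero pos] ln_exp)
  then show ?thesis
    using Hoeffdings_lemma_aux[of "- h" "1 - q"] assms False by (simp add: algebra_simps)
qed

lemma bernoulli_mgf_pos:
  fixes p u :: real
  assumes "0 \<le> p" "p \<le> 1"
  shows "1 + p * (exp u - 1) > 0"
proof (cases "p = 1")
  case False
  have "1 + p * (exp u - 1) = (1 - p) + p * exp u" by (simp add: algebra_simps)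
  moreover have "(1 - p) + p * exp u > 0"
    using False assms by (intro add_pos_nonneg) auto
  ultimately show ?thesis by simp
qed simp

text \<open>
  The left-hand side is \<open>Z\<close> times the relative entropy of the Bernoulli law with parameter
  \<open>q = p * exp u / Z\<close> with respect to the one with parameter \<open>p\<close>. The first law is the
  exponential tilt of the second by \<open>u\<close>, so the second is the tilt of the first by \<open>- u\<close>. Hence
  \<open>1 / Z\<close> is the moment generating function of the law with parameter \<open>q\<close> at \<open>- u\<close>, and the
  bound is Hoeffding's lemma for that law.
\<close>
lemma bernoulli_entropy_le:
  fixes p u :: real
  assumes "0 \<le> p" "p \<le> 1"
  defines "Z \<equiv> 1 + p * (exp u - 1)"
  shows "p * u * exp u - Z * ln Z \<le> u\<^sup>2 / 8 * Z"
proof -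
  have Z: "Z > 0" unfolding Z_def using bernoulli_mgf_pos assms by blast
  define q where "q = p * exp u / Z"
  have q: "0 \<le> q" "q \<le> 1"
    using assms Z by (auto simp: q_def field_simps Z_def)
  have "Z * q = p * exp u"
    using Z by (simp add: q_def)
  hence "Z * (1 + q * (exp (- u) - 1)) = Z + p * exp u * (exp (- u) - 1)"
    by (simp add: ring_distribs flip: mult.assoc)
  also have "\<dots> = 1"
    by (simp add: Z_def algebra_simps flip: exp_add)
  finally have "1 + q * (exp (- u) - 1) = inverse Z"
    by (rule inverse_unique[symmetric])
  hence "- ln Z + u * q \<le> u\<^sup>2 / 8"
    using ln_mgf_bernoulli_le[of q "- u"] q Z by (simp add: ln_inverse)
  hence "Z * (- ln Z + u * q) \<le> Z * (u\<^sup>2 / 8)"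
    using Z by (intro mult_left_mono) auto
  then show ?thesis
    using Z by (simp add: q_def algebra_simps)
qed

lemma (in prob_space) integral_exp_indicator:
  assumes A: "A \<in> events"
  shows "(\<integral>t. exp (a + u * indicator A t) \<partial>M) = exp a * (1 + prob A * (exp u - 1))"
proof -
  have "(\<integral>t. exp (a + u * indicator A t) \<partial>M) =
        (\<integral>t. exp a + exp a * (exp u - 1) * indicator A t \<partial>M)"
    by (intro Bochner_Integration.integral_cong)
       (auto simp: indicator_def exp_add algebra_simps)
  also have "\<dots> = exp a * (1 + prob A * (exp u - 1))"
    using A by (simp add: prob_space algebra_simps less_top[symmetric])
  finally show ?thesis .
qed

lemma (in prob_space) ent_exp_indicator:
  fixes a u :: real
  assumes A: "A \<in> events"
  defines "Z \<equiv> 1 + prob A * (exp u - 1)"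
  shows "ent M (\<lambda>t. exp (a + u * indicator A t)) = exp a * (prob A * u * exp u - Z * ln Z)"
proof -
  have Z: "Z > 0"
    unfolding Z_def by (rule bernoulli_mgf_pos) auto
  have "(\<integral>t. exp (a + u * indicator A t) * ln (exp (a + u * indicator A t)) \<partial>M) =
        (\<integral>t. exp a * a + exp a * (exp u * (a + u) - a) * indicator A t \<partial>M)"
    unfolding ln_exp
    by (intro Bochner_Integration.integral_cong)
       (auto simp: indicator_def exp_add algebra_simps)
  also have "\<dots> = exp a * (a * Z + prob A * u * exp u)"
    using A by (simp add: prob_space algebra_simps less_top[symmetric] Z_def)
  moreover have "ln (exp a * Z) = a + ln Z"
    using Z by (simp only: ln_mult_pos[OF exp_gt_zero Z] ln_exp)
  ultimately show ?thesis
    unfolding ent_def integral_exp_indicator[OF A] Z_def[symmetric]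
    by (simp add: algebra_simps)
qed

lemma (in finite_measure) ent_exists_exp:
  assumes g: "g \<in> borel_measurable M" and B: "\<And>x. x \<in> space M \<Longrightarrow> \<bar>g x\<bar> \<le> B"
  shows "ent_exists M (\<lambda>x. exp (g x))"
proof -
  note [measurable] = g
  have B0: "exp (g x) \<le> exp B" if "x \<in> space M" for x
    using B[OF that] by (simp add: abs_le_iff)
  show ?thesis
    unfolding ent_exists_def
  proof
    show "integrable M (\<lambda>x. exp (g x))"
      by (rule integrable_const_bound[where B = "exp B"]) (use B0 in auto)
    show "integrable M (\<lambda>x. exp (g x) * \<bar>ln (exp (g x))\<bar>)"
      by (rule integrable_const_bound[where B = "exp B * B"])
         (use B B0 in \<open>auto simp: abs_mult intro!: mult_mono\<close>)
  qed
qed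

section \<open>From entropy bounds to concentration\<close>

text \<open>
  The hypothesis says that \<open>k l / l\<close> is nonincreasing on either side of \<open>0\<close>, and at \<open>0\<close> this
  quotient tends to \<open>k' 0 = 0\<close>.
\<close>
lemma Herbst_differential_inequality:
  fixes k k' :: "real \<Rightarrow> real"
  assumes k: "\<And>l. (k has_real_derivative k' l) (at l)"
    and k0: "k 0 = 0" "k' 0 = 0"
    and ineq: "\<And>l. l * k' l \<le> k l"
  shows "k l \<le> 0"
proof -
  have *: "k l \<le> 0" if k: "\<And>l. (k has_real_derivative k' l) (at l)"
    and k0: "k 0 = 0" "k' 0 = 0"
    and ineq: "\<And>l. l * k' l \<le> k l" and l: "l > 0" for k k' :: "real \<Rightarrow> real" and l
  proof -
    have deriv: "((\<lambda>l. k l / l) has_real_derivative (k' l * l - k l) / (l * l)) (at l)" if "l > 0" for l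
      using that by (auto intro!: derivative_eq_intros k)
    have le: "k l / l \<le> k e / e" if e: "0 < e" "e < l" for e
    proof (rule DERIV_nonpos_imp_nonincreasing[where f = "\<lambda>l. k l / l"])
      show "e \<le> l" using e by simp
      fix x assume "e \<le> x" "x \<le> l"
      with e have "x > 0" by simp
      moreover have "(k' x * x - k x) / (x * x) \<le> 0"
        using ineq[of x] by (intro divide_nonpos_nonneg) (auto simp: mult.commute)
      ultimately show "\<exists>y. ((\<lambda>l. k l / l) has_real_derivative y) (at x) \<and> y \<le> 0"
        using deriv by blast
    qed
    have "((\<lambda>e. k e / e) \<longlongrightarrow> 0) (at 0)"
      using k[of 0] k0 by (simp add: has_field_derivative_iff)
    hence "((\<lambda>e. k e / e) \<longlongrightarrow> 0) (at_right 0)"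
      by (rule tendsto_within_subset) simp
    moreover have "eventually (\<lambda>e. k l / l \<le> k e / e) (at_right 0)"
      using eventually_at_right_less[of 0] eventually_at_right_real[OF l]
      by eventually_elim (auto intro: le)
    ultimately have "k l / l \<le> 0"
      by (intro tendsto_lowerbound) auto
    then show ?thesis using l by (simp add: divide_le_0_iff)
  qed
  consider "l > 0" | "l = 0" | "l < 0" by linarith
  then show ?thesis
  proof cases
    case 3
    have "((\<lambda>l. k (- l)) has_real_derivative - k' (- l)) (at l)" for l
      using DERIV_chain2[OF k DERIV_minus[OF DERIV_ident], of l] by simp
    hence "k (- (- l)) \<le> 0"
    proof (rule *)
      show "x * - k' (- x) \<le> k (- x)" for x
        using ineq[of "- x"] by simp
    qed (use k0 3 in auto)
    then show ?thesis by simp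
  qed (use *[OF k k0 ineq] k0 in auto)
qed

lemma simple_function_comp_eq_sum:
  fixes \<phi> :: "'b \<Rightarrow> real"
  assumes g: "simple_function M g" and x: "x \<in> space M"
  shows "\<phi> (g x) = (\<Sum>v\<in>g ` space M. \<phi> v * indicator (g -` {v} \<inter> space M) x)"
proof -
  have fin: "finite (g ` space M)" using g by (rule simple_functionD)
  have "(\<Sum>v\<in>g ` space M. \<phi> v * indicator (g -` {v} \<inter> space M) x) =
        (\<Sum>v\<in>g ` space M. if v = g x then \<phi> v else 0)"
    using x by (intro sum.cong) (auto simp: indicator_def)
  then show ?thesis using fin x by simp
qed

text \<open>
  For a function with finitely many values, the moment generating function is a finite sum of
  exponentials, so that it can be differentiated term by term.
\<close>
lemma (in finite_measure) integral_comp_simple_function: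
  fixes \<phi> :: "'b \<Rightarrow> real"
  assumes g: "simple_function M g"
  shows "integrable M (\<lambda>x. \<phi> (g x))"
    and "(\<integral>x. \<phi> (g x) \<partial>M) = (\<Sum>v\<in>g ` space M. \<phi> v * measure M (g -` {v} \<inter> space M))"
proof -
  have sets: "g -` {v} \<inter> space M \<in> sets M" for v
    using simple_functionD(2)[OF g] .
  have int: "integrable M (\<lambda>x. \<phi> v * indicator (g -` {v} \<inter> space M) x)" for v
    using sets[of v] by (simp add: less_top[symmetric])
  have "integrable M (\<lambda>x. \<Sum>v\<in>g ` space M. \<phi> v * indicator (g -` {v} \<inter> space M) x)"
    using int by simp
  then show "integrable M (\<lambda>x. \<phi> (g x))"
    by (subst Bochner_Integration.integrable_cong[OF refl simple_function_comp_eq_sum[OF g]])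
  have "(\<integral>x. \<phi> (g x) \<partial>M) =
        (\<integral>x. (\<Sum>v\<in>g ` space M. \<phi> v * indicator (g -` {v} \<inter> space M) x) \<partial>M)"
    by (intro Bochner_Integration.integral_cong refl simple_function_comp_eq_sum[OF g])
  also have "\<dots> = (\<Sum>v\<in>g ` space M. \<phi> v * measure M (g -` {v} \<inter> space M))"
    using sets by (subst Bochner_Integration.integral_sum[OF int]) simp
  finally show "(\<integral>x. \<phi> (g x) \<partial>M) =
      (\<Sum>v\<in>g ` space M. \<phi> v * measure M (g -` {v} \<inter> space M))" .
qed

text \<open>
  With \<open>H\<close> the moment generating function, the entropy of \<open>exp (l * g)\<close> is
  \<open>l * H' l - H l * ln (H l)\<close>. Dividing the assumed bound by \<open>H l\<close> turns it into the differential
  inequality above for \<open>k l = ln (H l) - l * expectation g - c * l\<^sup>2\<close>. The linear term makes \<open>k' 0 = 0\<close>.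
  The quadratic term lowers \<open>l * k' l\<close> by \<open>2 * c * l\<^sup>2\<close> and \<open>k l\<close> by only \<open>c * l\<^sup>2\<close>, which absorbs
  the bound on the entropy.
\<close>
lemma (in prob_space) Herbst_argument:
  fixes g :: "'a \<Rightarrow> real"
  assumes g: "simple_function M g"
    and ent: "\<And>l. ent M (\<lambda>x. exp (l * g x)) \<le> c * l\<^sup>2 * expectation (\<lambda>x. exp (l * g x))"
  shows "expectation (\<lambda>x. exp (l * g x)) \<le> exp (l * expectation g + c * l\<^sup>2)"
proof -
  define H where "H = (\<lambda>l. expectation (\<lambda>x. exp (l * g x)))"
  define H' where "H' = (\<lambda>l. expectation (\<lambda>x. g x * exp (l * g x)))"
  define k where "k = (\<lambda>l. ln (H l) - l * expectation g - c * l\<^sup>2)"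
  define k' where "k' = (\<lambda>l. H' l / H l - expectation g - 2 * c * l)"
  note int = integral_comp_simple_function[OF g]
  have H_pos: "H l > 0" for l
  proof -
    have "H l \<noteq> 0"
    proof
      assume "H l = 0"
      hence "AE x in M. exp (l * g x) = 0"
        unfolding H_def using int(1)[of "\<lambda>v. exp (l * v)"]
        by (subst (asm) integral_nonneg_eq_0_iff_AE) auto
      thus False using AE_False by simp
    qed
    moreover have "H l \<ge> 0" unfolding H_def by simp
    ultimately show ?thesis by simp
  qed
  have deriv_H: "(H has_real_derivative H' l) (at l)" for l
    unfolding H_def H'_def int(2)[of "\<lambda>v. exp (l * v)" for l] int(2)[of "\<lambda>v. v * exp (l * v)" for l]
    by (rule derivative_eq_intros refl | simp)+ (simp add: mult_ac)
  have deriv_k: "(k has_real_derivative k' l) (at l)" for l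
    unfolding k_def k'_def using H_pos[of l]
    by (auto intro!: derivative_eq_intros deriv_H)
  have "l * k' l \<le> k l" for l
  proof -
    have "(\<integral>x. exp (l * g x) * ln (exp (l * g x)) \<partial>M) = l * H' l"
      unfolding H'_def ln_exp by (subst integral_mult_right_zero[symmetric]) (simp add: mult_ac)
    hence "l * H' l - H l * ln (H l) \<le> c * l\<^sup>2 * H l"
      using ent[of l] by (simp add: ent_def H_def)
    hence "(l * H' l - H l * ln (H l)) / H l \<le> c * l\<^sup>2"
      using H_pos[of l] by (simp add: pos_divide_le_eq)
    hence "l * (H' l / H l) - ln (H l) \<le> c * l\<^sup>2"
      using H_pos[of l] by (simp add: diff_divide_distrib)
    then show ?thesis
      by (simp add: k_def k'_def algebra_simps power2_eq_square)
  qed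
  moreover have "k 0 = 0" "k' 0 = 0"
    by (simp_all add: k_def k'_def H_def H'_def prob_space)
  ultimately have "k l \<le> 0"
    using deriv_k by (intro Herbst_differential_inequality[of k k'])
  hence "exp (ln (H l)) \<le> exp (l * expectation g + c * l\<^sup>2)"
    unfolding k_def exp_le_cancel_iff by linarith
  then show ?thesis
    unfolding exp_ln[OF H_pos] unfolding H_def .
qed

lemma (in prob_space) Chernoff_subgaussian:
  fixes g :: "'a \<Rightarrow> real"
  assumes g: "g \<in> borel_measurable M"
    and int: "\<And>l. integrable M (\<lambda>x. exp (l * g x))"
    and mgf: "\<And>l. expectation (\<lambda>x. exp (l * g x)) \<le> exp (l * m + c * l\<^sup>2)"
    and c: "c > 0" and t: "t \<ge> 0"
  shows "prob {x \<in> space M. \<bar>m - g x\<bar> \<ge> t} \<le> 2 * exp (- t\<^sup>2 / (4 * c))"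
proof -
  note [measurable] = g
  have tail: "prob {x \<in> space M. s * (g x - m) \<ge> t} \<le> exp (- t\<^sup>2 / (4 * c))" if s: "s\<^sup>2 = 1" for s
  proof -
    \<comment> \<open>the minimizer of \<open>c * l\<^sup>2 - l * t\<close>; the sign \<open>s\<close> selects the upper or the lower tail\<close>
    define l where "l = t / (2 * c)"
    have l: "l \<ge> 0" using c t by (simp add: l_def)
    have "prob {x \<in> space M. s * (g x - m) \<ge> t} \<le> prob {x \<in> space M. exp ((l * s) * g x) \<ge> exp (l * t + l * s * m)}"
    proof (intro finite_measure_mono subsetI)
      fix x assume "x \<in> {x \<in> space M. s * (g x - m) \<ge> t}"
      hence "l * t \<le> l * (s * (g x - m))" "x \<in> space M" using l by (auto intro: mult_left_mono)
      thus "x \<in> {x \<in> space M. exp ((l * s) * g x) \<ge> exp (l * t + l * s * m)}"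
        by (simp add: algebra_simps)
    qed measurable
    also have "\<dots> \<le> expectation (\<lambda>x. exp ((l * s) * g x)) / exp (l * t + l * s * m)"
      by (rule integral_Markov_inequality_measure[OF int, of "{}"]) auto
    also have "\<dots> \<le> exp (l * s * m + c * (l * s)\<^sup>2) / exp (l * t + l * s * m)"
      by (intro divide_right_mono mgf) simp
    also have "\<dots> = exp (c * l\<^sup>2 - l * t)"
      by (simp add: s power_mult_distrib flip: exp_diff)
    also have "c * l\<^sup>2 - l * t = - t\<^sup>2 / (4 * c)"
      using c by (simp add: l_def field_simps power2_eq_square)
    finally show ?thesis .
  qed
  have "{x \<in> space M. \<bar>m - g x\<bar> \<ge> t} =
        {x \<in> space M. 1 * (g x - m) \<ge> t} \<union> {x \<in> space M. (-1) * (g x - m) \<ge> t}"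
    by auto
  hence "prob {x \<in> space M. \<bar>m - g x\<bar> \<ge> t} \<le>
        prob {x \<in> space M. 1 * (g x - m) \<ge> t} + prob {x \<in> space M. (-1) * (g x - m) \<ge> t}"
    by (simp only:) (intro measure_Un_le; measurable)
  then show ?thesis using tail[of 1] tail[of "-1"] by simp
qed

section \<open>Disintegration along a conditional law\<close>

lemma vec_nth_borel_measurable [measurable]: "(\<lambda>x :: real ^ 'n. x $ i) \<in> borel_measurable borel"
  by (intro borel_measurable_continuous_onI continuous_intros)

lemma measurable_others [measurable]:
  "others i \<in> measurable borel (PiM (- {i}) (\<lambda>_. borel))"
  unfolding others_def by measurable

lemma empirical_cdf_borel_measurable [measurable]:
  "(\<lambda>x. empirical_cdf x s) \<in> borel_measurable borel"
  unfolding empirical_cdf_def by measurable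

lemma empirical_cdf_bounds: "0 \<le> empirical_cdf x s" "empirical_cdf x s \<le> 1"
proof -
  have "(\<Sum>i\<in>UNIV. indicator {..s} (x $ i)) \<le> (\<Sum>i\<in>(UNIV :: 'a set). 1 :: real)"
    by (intro sum_mono) (simp add: indicator_def)
  then show "empirical_cdf x s \<le> 1"
    by (simp add: empirical_cdf_def)
qed (simp add: empirical_cdf_def sum_nonneg)

lemma cond_law_prob_space:
  assumes K: "is_cond_law \<nu> i K"
  shows "prob_space (K (others i x))" "sets (K (others i x)) = sets borel"
proof -
  have "others i x \<in> space (PiM (- {i}) (\<lambda>_. borel))"
    by (auto simp: others_def space_PiM)
  with K have "K (others i x) \<in> space (prob_algebra borel)"
    unfolding is_cond_law_def by (blast dest: measurable_space)
  then show "prob_space (K (others i x))" "sets (K (others i x)) = sets borel"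
    by (simp_all add: space_prob_algebra)
qed

lemma cond_law_measurable:
  assumes K: "is_cond_law \<nu> i K" and \<nu>: "sets \<nu> = sets borel" and A: "A \<in> sets borel"
  shows "(\<lambda>x. measure (K (others i x)) A) \<in> borel_measurable \<nu>"
proof -
  have [measurable]: "K \<in> measurable (PiM (- {i}) (\<lambda>_. borel)) (prob_algebra borel)"
    using K unfolding is_cond_law_def by blast
  have "(\<lambda>x. measure (K (others i x)) A) \<in> borel_measurable borel"
    using A by measurable
  then show ?thesis
    by (simp cong: measurable_cong_sets add: measurable_cong_sets[OF \<nu> refl])
qed

text \<open>
  A function of the other coordinates is measurable for the conditioning sigma-algebra, so it may
  be pulled into the conditional expectation of the event that the \<open>i\<close>-th coordinate lies in \<open>A\<close>.
\<close>
lemma integral_cond_law: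
  fixes \<nu> :: "(real ^ 'n::finite) measure"
  assumes "prob_space \<nu>" and \<nu>: "sets \<nu> = sets borel"
    and K: "is_cond_law \<nu> i K" and A: "A \<in> sets borel"
    and w: "w \<in> borel_measurable (PiM (- {i}) (\<lambda>_. borel))"
    and int: "integrable \<nu> (\<lambda>x. w (others i x))"
  shows "(\<integral>x. w (others i x) * measure (K (others i x)) A \<partial>\<nu>) =
         (\<integral>x. w (others i x) * indicator A (x $ i) \<partial>\<nu>)"
proof -
  interpret prob_space \<nu> by fact
  note [measurable_cong] = \<nu>
  let ?P = "PiM (- {i}) (\<lambda>_. borel) :: ('n \<Rightarrow> real) measure"
  let ?F = "vimage_algebra (space \<nu>) (others i) ?P"
  have others: "others i \<in> measurable \<nu> ?P" by measurable
  have "subalgebra \<nu> ?F"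
    using measurable_sets[OF others] by (auto simp: subalgebra_def sets_vimage_algebra2 measurable_space[OF others] Pi_iff)
  then interpret finite_measure_subalgebra \<nu> ?F
    by unfold_locales
  have ind: "indicator {y. y $ i \<in> A} x = (indicator A (x $ i) :: real)" for x :: "real ^ 'n"
    by (simp add: indicator_def)
  have [measurable]: "(indicator {y. y $ i \<in> A} :: real ^ 'n \<Rightarrow> real) \<in> borel_measurable \<nu>"
    using A unfolding ind[abs_def] by measurable
  have wF: "(\<lambda>x. w (others i x)) \<in> borel_measurable ?F"
    using measurable_space[OF others]
    by (intro measurable_compose[OF measurable_vimage_algebra1 w]) auto
  have "AE x in \<nu>. w (others i x) * measure (K (others i x)) A =
      w (others i x) * real_cond_exp \<nu> ?F (indicator {y. y $ i \<in> A}) x"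
  proof -
    have "AE x in \<nu>. measure (K (others i x)) A = real_cond_exp \<nu> ?F (indicator {y. y $ i \<in> A}) x"
      using K A unfolding is_cond_law_def by blast
    then show ?thesis by eventually_elim simp
  qed
  hence "(\<integral>x. w (others i x) * measure (K (others i x)) A \<partial>\<nu>) =
      (\<integral>x. w (others i x) * real_cond_exp \<nu> ?F (indicator {y. y $ i \<in> A}) x \<partial>\<nu>)"
    using cond_law_measurable[OF K \<nu> A] measurable_compose[OF others w]
    by (intro integral_cong_AE) (auto intro!: borel_measurable_times borel_measurable_cond_exp2)
  also have "\<dots> = (\<integral>x. w (others i x) * indicator {y. y $ i \<in> A} x \<partial>\<nu>)"
  proof (rule real_cond_exp_intg(2)[OF _ wF])
    show "integrable \<nu> (\<lambda>x. w (others i x) * indicator {y. y $ i \<in> A} x)"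
    proof (rule Bochner_Integration.integrable_bound[OF int])
      show "(\<lambda>x. w (others i x) * indicator {y. y $ i \<in> A} x) \<in> borel_measurable \<nu>"
        using measurable_compose[OF others w] by measurable
    qed (simp add: indicator_def)
  qed measurable
  finally show ?thesis by (simp only: ind)
qed

section \<open>Concentration of the empirical distribution function at a point\<close>

text \<open>
  For fixed other coordinates, \<open>exp (l * empirical_cdf x s)\<close> takes only two values as a function of
  the \<open>i\<close>-th coordinate, in the ratio \<open>exp (l / n)\<close>. Its conditional entropy and mean are therefore
  explicit in the conditional probability \<open>p i\<close> of the event that this coordinate is at most \<open>s\<close>,
  and the former is at most \<open>(l / n)\<^sup>2 / 8\<close> times the latter. The conditional means integrate to the
  full mean, so that the sum over the \<open>n\<close> coordinates leaves a single factor \<open>1 / n\<close>.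
\<close>
lemma approx_tensorization_exp_empirical_cdf:
  fixes \<nu> :: "(real ^ 'n::finite) measure"
  assumes "prob_space \<nu>" and \<nu>: "sets \<nu> = sets borel"
    and "\<kappa> \<ge> 0" and ate: "approx_tensorization \<nu> \<kappa>"
  shows "ent \<nu> (\<lambda>x. exp (l * empirical_cdf x s)) \<le>
           \<kappa> / (8 * real CARD('n)) * l\<^sup>2 * (\<integral>x. exp (l * empirical_cdf x s) \<partial>\<nu>)"
proof -
  interpret prob_space \<nu> by fact
  note [measurable_cong] = \<nu>
  define n where "n = real CARD('n)"
  have n: "n > 0" by (simp add: n_def)
  define u where "u = l / n"
  define A where "A = {..s}"
  have A: "A \<in> sets borel" by (simp add: A_def)
  define f where "f = (\<lambda>x :: real ^ 'n. exp (l * empirical_cdf x s))"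
  \<comment> \<open>the part of the exponent that does not involve the \<open>i\<close>-th coordinate\<close>
  define b where "b = (\<lambda>i (y :: 'n \<Rightarrow> real). u * (\<Sum>j\<in>- {i}. indicator A (y j)))"
  obtain K where K: "\<And>i. is_cond_law \<nu> i (K i)"
    and ateK: "\<And>f. (\<forall>x. 0 \<le> f x) \<Longrightarrow> ent_exists \<nu> f \<Longrightarrow>
          (\<forall>i. AE x in \<nu>. ent_exists (K i (others i x)) (slice i x f)) \<Longrightarrow>
          (\<forall>i. integrable \<nu> (\<lambda>x. ent (K i (others i x)) (slice i x f))) \<Longrightarrow>
          ent \<nu> f \<le> \<kappa> * (\<Sum>i\<in>UNIV. \<integral>x. ent (K i (others i x)) (slice i x f) \<partial>\<nu>)"
    using ate unfolding approx_tensorization_def by blast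
  define p where "p = (\<lambda>i x. measure (K i (others i x)) A)"
  \<comment> \<open>\<open>exp (b i (others i x)) * Z i x\<close> is the conditional mean of \<open>f\<close>\<close>
  define Z where "Z = (\<lambda>i x. 1 + p i x * (exp u - 1))"
  have p: "0 \<le> p i x" "p i x \<le> 1" for i x
    using prob_space.prob_le_1[OF cond_law_prob_space(1)[OF K]] by (auto simp: p_def)
  have p_meas [measurable]: "p i \<in> borel_measurable \<nu>" for i
    unfolding p_def by (rule cond_law_measurable[OF K \<nu> A])
  have b_meas: "b i \<in> borel_measurable (PiM (- {i}) (\<lambda>_. borel))" for i
    using A unfolding b_def by measurable
  have b_meas' [measurable]: "(\<lambda>x. b i (others i x)) \<in> borel_measurable \<nu>" for i
    using measurable_compose[OF measurable_others b_meas]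
    by (simp add: measurable_cong_sets[OF \<nu> refl])
  have b_bound: "\<bar>b i y\<bar> \<le> \<bar>u\<bar> * n" for i y
  proof -
    have "\<bar>\<Sum>j\<in>- {i}. indicator A (y j) :: real\<bar> \<le> (\<Sum>j\<in>- {i}. 1)"
      by (rule order.trans[OF sum_abs sum_mono]) (simp add: indicator_def)
    also have "\<dots> \<le> (\<Sum>j\<in>(UNIV :: 'n set). 1)"
      by (rule sum_mono2) auto
    finally show ?thesis
      by (simp add: b_def abs_mult n_def mult_left_mono)
  qed
  have slice: "slice i x f = (\<lambda>t. exp (b i (others i x) + u * indicator A t))" for i x
  proof
    fix t
    have "(\<Sum>j\<in>UNIV. indicator A ((\<chi> j. if j = i then t else x $ j) $ j)) =
        indicator A t + (\<Sum>j\<in>- {i}. indicator A (x $ j) :: real)"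
      by (subst sum.remove[of _ i]) (auto simp: Compl_eq_Diff_UNIV intro!: sum.cong)
    moreover have "(\<Sum>j\<in>- {i}. indicator A (others i x j)) = (\<Sum>j\<in>- {i}. indicator A (x $ j) :: real)"
      by (intro sum.cong) (auto simp: others_def)
    ultimately show "slice i x f t = exp (b i (others i x) + u * indicator A t)"
      by (simp add: slice_def f_def empirical_cdf_def b_def u_def n_def A_def field_simps)
  qed
  have f_split: "f x = exp (b i (others i x) + u * indicator A (x $ i))" for i x
  proof -
    have "(\<chi> j. if j = i then x $ i else x $ j) = x" by (simp add: vec_eq_iff)
    hence "f x = slice i x f (x $ i)" by (simp add: slice_def)
    then show ?thesis by (simp add: slice)
  qed
  have ent_slice: "ent (K i (others i x)) (slice i x f) =
      exp (b i (others i x)) * (p i x * u * exp u - Z i x * ln (Z i x))" for i x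
    unfolding slice p_def Z_def
    using cond_law_prob_space[OF K] A by (intro prob_space.ent_exp_indicator) auto
  have Z_pos: "Z i x > 0" for i x
    unfolding Z_def by (rule bernoulli_mgf_pos[OF p])
  have ent_slice_le: "ent (K i (others i x)) (slice i x f) \<le> u\<^sup>2 / 8 * (exp (b i (others i x)) * Z i x)" for i x
    using mult_left_mono[OF bernoulli_entropy_le[OF p, of i x u], of "exp (b i (others i x))"]
    unfolding ent_slice Z_def by (simp add: mult_ac)
  have int_b: "integrable \<nu> (\<lambda>x. exp (b i (others i x)) * w x)"
    if w [measurable]: "w \<in> borel_measurable \<nu>" and W: "\<And>x. \<bar>w x\<bar> \<le> W" for i w W
  proof (rule integrable_const_bound[where B = "exp (\<bar>u\<bar> * n) * W"])
    show "AE x in \<nu>. norm (exp (b i (others i x)) * w x) \<le> exp (\<bar>u\<bar> * n) * W"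
      using b_bound W by (auto simp: abs_mult abs_le_iff intro!: mult_mono)
  qed measurable
  have int_Z: "(\<integral>x. exp (b i (others i x)) * Z i x \<partial>\<nu>) = (\<integral>x. f x \<partial>\<nu>)"
    and integrable_Z: "integrable \<nu> (\<lambda>x. exp (b i (others i x)) * Z i x)" for i
  proof -
    note e = int_b[of "\<lambda>_. 1" 1 i, simplified]
    have ep: "integrable \<nu> (\<lambda>x. exp (b i (others i x)) * p i x)"
      using p by (intro int_b[of _ 1]) auto
    have ei: "integrable \<nu> (\<lambda>x. exp (b i (others i x)) * indicator A (x $ i))"
      using A by (intro int_b[of _ 1]) (auto simp: indicator_def)
    have swap: "(\<integral>x. exp (b i (others i x)) * p i x \<partial>\<nu>) =
        (\<integral>x. exp (b i (others i x)) * indicator A (x $ i) \<partial>\<nu>)"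
      unfolding p_def
      using integral_cond_law[OF \<open>prob_space \<nu>\<close> \<nu> K A, of "\<lambda>y. exp (b i y)" i] b_meas e by simp
    have *: "exp (b i (others i x)) * Z i x =
        exp (b i (others i x)) + (exp u - 1) * (exp (b i (others i x)) * p i x)" for x
      by (simp add: Z_def algebra_simps)
    have **: "f x =
        exp (b i (others i x)) + (exp u - 1) * (exp (b i (others i x)) * indicator A (x $ i))" for x
      unfolding f_split[of x i] by (simp add: exp_add indicator_def algebra_simps)
    show "integrable \<nu> (\<lambda>x. exp (b i (others i x)) * Z i x)"
      unfolding * using e ep by simp
    show "(\<integral>x. exp (b i (others i x)) * Z i x \<partial>\<nu>) = (\<integral>x. f x \<partial>\<nu>)"
      unfolding * ** using e ep ei swap by simp
  qed
  \<comment> \<open>\<open>Z\<close> is a convex combination of \<open>1\<close> and \<open>exp u\<close>; hence its logarithm is bounded\<close>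
  have integrable_ent: "integrable \<nu> (\<lambda>x. ent (K i (others i x)) (slice i x f))" for i
  proof -
    define Zmin where "Zmin = min 1 (exp u)"
    define Zmax where "Zmax = max 1 (exp u)"
    have Z_bounds: "Zmin \<le> Z i x" "Z i x \<le> Zmax" for x
    proof -
      have "Z i x = (1 - p i x) * 1 + p i x * exp u" by (simp add: Z_def algebra_simps)
      moreover have "(1 - p i x) * Zmin + p i x * Zmin \<le> (1 - p i x) * 1 + p i x * exp u"
        using p[of i x] by (intro add_mono mult_left_mono) (auto simp: Zmin_def)
      moreover have "(1 - p i x) * 1 + p i x * exp u \<le> (1 - p i x) * Zmax + p i x * Zmax"
        using p[of i x] by (intro add_mono mult_left_mono) (auto simp: Zmax_def)
      ultimately show "Zmin \<le> Z i x" "Z i x \<le> Zmax" by (simp_all add: algebra_simps)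
    qed
    have Zmin: "Zmin > 0" by (simp add: Zmin_def)
    have ln_Z: "\<bar>ln (Z i x)\<bar> \<le> \<bar>u\<bar>" for x
    proof -
      have "ln (Z i x) \<le> ln Zmax" "ln Zmin \<le> ln (Z i x)"
        using Z_bounds[of x] Z_pos[of i x] Zmin by (auto intro!: ln_mono)
      moreover have "\<bar>ln Zmax\<bar> \<le> \<bar>u\<bar>" "\<bar>ln Zmin\<bar> \<le> \<bar>u\<bar>"
        by (auto simp: Zmax_def Zmin_def max_def min_def)
      ultimately show ?thesis by linarith
    qed
    show ?thesis
      unfolding ent_slice
    proof (rule int_b)
      show "(\<lambda>x. p i x * u * exp u - Z i x * ln (Z i x)) \<in> borel_measurable \<nu>"
        unfolding Z_def by measurable
      fix x
      have "\<bar>p i x * u * exp u - Z i x * ln (Z i x)\<bar> \<le> p i x * \<bar>u\<bar> * exp u + Z i x * \<bar>ln (Z i x)\<bar>"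
        using p[of i x] Z_pos[of i x] by (intro order.trans[OF abs_triangle_ineq4]) (simp add: abs_mult)
      also have "\<dots> \<le> 1 * \<bar>u\<bar> * exp u + Zmax * \<bar>u\<bar>"
        using p[of i x] Z_bounds[of x] Z_pos[of i x] ln_Z[of x] by (intro add_mono mult_mono) auto
      finally show "\<bar>p i x * u * exp u - Z i x * ln (Z i x)\<bar> \<le> 1 * \<bar>u\<bar> * exp u + Zmax * \<bar>u\<bar>" .
    qed
  qed
  have "ent \<nu> f \<le> \<kappa> * (\<Sum>i\<in>UNIV. \<integral>x. ent (K i (others i x)) (slice i x f) \<partial>\<nu>)"
  proof (intro ateK allI AE_I2)
    show "ent_exists \<nu> f"
      unfolding f_def
      by (rule ent_exists_exp[where B = "\<bar>l\<bar>"])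
         (auto simp: abs_mult abs_of_nonneg[OF empirical_cdf_bounds(1)] empirical_cdf_bounds intro!: mult_left_le)
    show "ent_exists (K i (others i x)) (slice i x f)" for i x
    proof -
      interpret Ki: prob_space "K i (others i x)" by (rule cond_law_prob_space[OF K])
      have A': "A \<in> sets (K i (others i x))" using A cond_law_prob_space(2)[OF K] by simp
      show ?thesis
        unfolding slice
        by (rule Ki.ent_exists_exp[where B = "\<bar>b i (others i x)\<bar> + \<bar>u\<bar>"])
           (use A' in \<open>auto simp: indicator_def\<close>)
    qed
  qed (use integrable_ent in \<open>auto simp: f_def\<close>)
  also have "\<dots> \<le> \<kappa> * (\<Sum>i\<in>(UNIV :: 'n set). u\<^sup>2 / 8 * (\<integral>x. f x \<partial>\<nu>))"
  proof (intro mult_left_mono sum_mono)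
    fix i :: 'n
    have "(\<integral>x. ent (K i (others i x)) (slice i x f) \<partial>\<nu>) \<le>
        (\<integral>x. u\<^sup>2 / 8 * (exp (b i (others i x)) * Z i x) \<partial>\<nu>)"
      using integrable_ent integrable_Z ent_slice_le by (intro integral_mono) auto
    then show "(\<integral>x. ent (K i (others i x)) (slice i x f) \<partial>\<nu>) \<le> u\<^sup>2 / 8 * (\<integral>x. f x \<partial>\<nu>)"
      by (simp add: int_Z)
  qed fact
  also have "\<dots> = \<kappa> / (8 * n) * l\<^sup>2 * (\<integral>x. f x \<partial>\<nu>)"
    using n by (simp add: u_def n_def[symmetric] field_simps power2_eq_square)
  finally show ?thesis
    by (simp only: f_def n_def)
qed

lemma empirical_cdf_mono: "mono (empirical_cdf v)"
  unfolding empirical_cdf_def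
  by (intro monoI divide_right_mono sum_mono) (auto simp: indicator_def)

lemma simple_function_empirical_cdf:
  fixes \<nu> :: "(real ^ 'n::finite) measure"
  assumes \<nu>: "sets \<nu> = sets borel"
  shows "simple_function \<nu> (\<lambda>v. empirical_cdf v s)"
proof (rule simple_function_borel_measurable)
  show "(\<lambda>v. empirical_cdf v s) \<in> borel_measurable \<nu>"
    by (simp add: measurable_cong_sets[OF \<nu> refl])
  have "empirical_cdf v s = real (card {i. v $ i \<le> s}) / real CARD('n)" for v :: "real ^ 'n"
    by (simp add: empirical_cdf_def indicator_def sum.If_cases)
  moreover have "card {i. v $ i \<le> s} \<le> CARD('n)" for v :: "real ^ 'n"
    by (rule card_mono) auto
  ultimately have "(\<lambda>v. empirical_cdf v s) ` space \<nu> \<subseteq> (\<lambda>k. real k / real CARD('n)) ` {..CARD('n)}"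
    by auto
  then show "finite ((\<lambda>v. empirical_cdf v s) ` space \<nu>)"
    by (rule finite_subset) simp
qed

text \<open>
  Herbst's argument and Chernoff's bound apply with \<open>c = \<kappa> / (8 * n)\<close>, and then
  \<open>t\<^sup>2 / (4 * c) = 2 * n * t\<^sup>2 / \<kappa>\<close>.
\<close>
lemma empirical_cdf_concentration:
  fixes \<nu> :: "(real ^ 'n::finite) measure"
  assumes "prob_space \<nu>" and \<nu>: "sets \<nu> = sets borel"
    and \<kappa>: "\<kappa> > 0" and ate: "approx_tensorization \<nu> \<kappa>" and t: "t \<ge> 0"
  shows "measure \<nu> {v \<in> space \<nu>. \<bar>(\<integral>v. empirical_cdf v s \<partial>\<nu>) - empirical_cdf v s\<bar> \<ge> t}
           \<le> 2 * exp (- 2 * real CARD('n) * t\<^sup>2 / \<kappa>)"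
proof -
  interpret prob_space \<nu> by fact
  define c where "c = \<kappa> / (8 * real CARD('n))"
  have c: "c > 0" using \<kappa> by (simp add: c_def)
  note simple = simple_function_empirical_cdf[OF \<nu>]
  have "measure \<nu> {v \<in> space \<nu>. \<bar>(\<integral>v. empirical_cdf v s \<partial>\<nu>) - empirical_cdf v s\<bar> \<ge> t}
      \<le> 2 * exp (- t\<^sup>2 / (4 * c))"
  proof (rule Chernoff_subgaussian[OF _ _ _ c t])
    show "(\<lambda>v. empirical_cdf v s) \<in> borel_measurable \<nu>"
      by (simp add: measurable_cong_sets[OF \<nu> refl])
    show "integrable \<nu> (\<lambda>v. exp (l * empirical_cdf v s))" for l
      by (rule integral_comp_simple_function(1)[OF simple])
    show "(\<integral>v. exp (l * empirical_cdf v s) \<partial>\<nu>) \<le>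
        exp (l * (\<integral>v. empirical_cdf v s \<partial>\<nu>) + c * l\<^sup>2)" for l
      unfolding c_def using \<kappa>
      by (intro Herbst_argument simple approx_tensorization_exp_empirical_cdf ate \<nu> \<open>prob_space \<nu>\<close>) simp
  qed
  also have "- t\<^sup>2 / (4 * c) = - 2 * real CARD('n) * t\<^sup>2 / \<kappa>"
    using \<kappa> by (simp add: c_def field_simps)
  finally show ?thesis .
qed

section \<open>Uniform deviations from finitely many points\<close>

lemma avg_cdf_limits:
  fixes X :: "'a \<Rightarrow> real ^ 'n::finite"
  assumes "prob_space M" and X: "X \<in> borel_measurable M"
  shows "(avg_cdf M X \<longlongrightarrow> 0) at_bot" "(avg_cdf M X \<longlongrightarrow> 1) at_top"
proof -
  interpret prob_space M by fact
  have Xi [measurable]: "(\<lambda>\<omega>. X \<omega> $ i) \<in> borel_measurable M" for i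
    using X by measurable
  define D where "D = (\<lambda>i. distr M borel (\<lambda>\<omega>. X \<omega> $ i))"
  have D: "real_distribution (D i)" for i
    unfolding D_def by (rule real_distribution_distr[OF Xi])
  have eq: "avg_cdf M X = (\<lambda>x. (\<Sum>i\<in>UNIV. cdf (D i) x) / real CARD('n))"
    unfolding avg_cdf_eq[OF assms] cdf_def D_def
    by (subst measure_distr) (auto simp: vimage_def Int_def conj_commute)
  have "((\<lambda>x. (\<Sum>i\<in>UNIV. cdf (D i) x) / real CARD('n)) \<longlongrightarrow> (\<Sum>i\<in>(UNIV :: 'n set). 0) / real CARD('n)) at_bot"
    using D by (intro tendsto_intros finite_borel_measure.cdf_lim_at_bot)
      (auto simp: real_distribution.finite_borel_measure_M)
  then show "(avg_cdf M X \<longlongrightarrow> 0) at_bot"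
    by (simp add: eq)
  have "((\<lambda>x. (\<Sum>i\<in>UNIV. cdf (D i) x) / real CARD('n)) \<longlongrightarrow> (\<Sum>i\<in>(UNIV :: 'n set). 1) / real CARD('n)) at_top"
    using D by (intro tendsto_intros real_distribution.cdf_lim_at_top_prob) auto
  then show "(avg_cdf M X \<longlongrightarrow> 1) at_top"
    by (simp add: eq)
qed

lemma continuous_cdf_attains:
  fixes F :: "real \<Rightarrow> real"
  assumes cont: "continuous_on UNIV F"
    and bot: "(F \<longlongrightarrow> 0) at_bot" and top: "(F \<longlongrightarrow> 1) at_top"
    and y: "0 < y" "y < 1"
  obtains x where "F x = y"
proof -
  have "eventually (\<lambda>x. F x < y) at_bot" "eventually (\<lambda>x. F x > y) at_top"
    using order_tendstoD(2)[OF bot y(1)] order_tendstoD(1)[OF top y(2)] .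
  then obtain a b where a: "\<And>x. x \<le> a \<Longrightarrow> F x < y" and b: "\<And>x. x \<ge> b \<Longrightarrow> F x > y"
    unfolding eventually_at_bot_linorder eventually_at_top_linorder by auto
  have "\<exists>x\<ge>min a b. x \<le> b \<and> F x = y"
  proof (rule IVT')
    show "F (min a b) \<le> y" using a[of "min a b"] by simp
    show "y \<le> F b" using b[of b] by simp
  qed (auto intro: continuous_on_subset[OF cont])
  then show thesis using that by blast
qed

text \<open>
  Each point lies between two neighbouring quantiles (or beyond the outermost one), between which
  \<open>F\<close> grows by at most \<open>1 / (m + 1)\<close>. Monotonicity of \<open>G\<close> bounds the deviation there by the one
  at the quantile on the appropriate side plus this increment.
\<close>
lemma deviation_le_grid:
  fixes F G :: "real \<Rightarrow> real" and m :: nat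
  assumes mono: "mono F" "mono G"
    and F: "\<And>x. 0 \<le> F x" "\<And>x. F x \<le> 1" and G: "\<And>x. 0 \<le> G x" "\<And>x. G x \<le> 1"
    and grid: "\<And>j. j \<in> {1..m} \<Longrightarrow> F (q j) = real j / real (m + 1)"
    and dev: "\<And>j. j \<in> {1..m} \<Longrightarrow> \<bar>F (q j) - G (q j)\<bar> \<le> d" and d: "0 \<le> d"
  shows "\<bar>F x - G x\<bar> \<le> d + 1 / real (m + 1)"
proof -
  define y where "y = real (m + 1) * F x"
  have y: "F x = y / real (m + 1)" "0 \<le> y" "y \<le> real (m + 1)"
    using F[of x] by (auto simp: y_def mult_left_le)
  have "G x - F x \<le> d + 1 / real (m + 1)"
  proof (cases "y \<ge> real m")
    case True
    have "1 - 1 / real (m + 1) = real m / real (m + 1)"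
      by (simp add: field_simps)
    also have "\<dots> \<le> F x"
      unfolding y(1) using True by (intro divide_right_mono) auto
    finally show ?thesis using G(2)[of x] d by linarith
  next
    case False
    \<comment> \<open>the first quantile whose level exceeds \<open>F x\<close>\<close>
    define j where "j = nat \<lfloor>y\<rfloor> + 1"
    have j: "y < real j" "real j \<le> y + 1"
      using y(2) by (auto simp: j_def) linarith+
    have j_in: "j \<in> {1..m}" using j False by (auto simp: j_def)
    have "F x < F (q j)"
      unfolding grid[OF j_in] y(1) using j by (intro divide_strict_right_mono) auto
    hence "x \<le> q j" using monoD[OF mono(1), of "q j" x] by linarith
    hence "G x \<le> G (q j)" by (rule monoD[OF mono(2)])
    moreover have "F (q j) \<le> F x + 1 / real (m + 1)"
      unfolding grid[OF j_in] y(1) using j by (simp add: divide_right_mono flip: add_divide_distrib)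
    ultimately show ?thesis using dev[OF j_in] by linarith
  qed
  moreover have "F x - G x \<le> d + 1 / real (m + 1)"
  proof (cases "y \<le> 1")
    case True
    hence "F x \<le> 1 / real (m + 1)"
      unfolding y by (simp add: divide_right_mono)
    then show ?thesis using G(1)[of x] d by linarith
  next
    case False
    \<comment> \<open>the last quantile at which \<open>F\<close> is strictly below \<open>F x\<close>\<close>
    define j where "j = nat (\<lceil>y\<rceil> - 1)"
    have j: "real j < y" "y \<le> real j + 1"
      using False by (auto simp: j_def) linarith+
    have j_in: "j \<in> {1..m}" using j False y(3) by auto
    have "F (q j) < F x"
      unfolding grid[OF j_in] y(1) using j by (intro divide_strict_right_mono) auto
    hence "q j \<le> x" using monoD[OF mono(1), of x "q j"] by linarith
    hence "G (q j) \<le> G x" by (rule monoD[OF mono(2)])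
    moreover have "F x \<le> F (q j) + 1 / real (m + 1)"
      unfolding grid[OF j_in] y(1) using j by (simp add: divide_right_mono flip: add_divide_distrib)
    ultimately show ?thesis using dev[OF j_in] by linarith
  qed
  ultimately show ?thesis by linarith
qed

theorem theorem4p9:
  fixes \<nu> :: "(real ^ 'n) measure" and M :: "'a measure" and X :: "'a \<Rightarrow> real ^ 'n"
    and \<kappa> r :: real
  assumes "prob_space \<nu>" and "sets \<nu> = sets borel"
    and "\<kappa> \<ge> 1" and "approx_tensorization \<nu> \<kappa>"
    and "prob_space M" and "X \<in> borel_measurable M" and "distr M borel X = \<nu>"
    and "continuous_on UNIV (avg_cdf M X)"
    and "r > 0"
  shows "\<P>(\<omega> in M. (SUP x. \<bar>avg_cdf M X x - empirical_cdf (X \<omega>) x\<bar>) \<ge> r)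
           \<le> 4 / r * exp (- (real CARD('n) * r\<^sup>2 / (2 * \<kappa>)))"
proof -
  interpret M: prob_space M by fact
  note X [measurable] = \<open>X \<in> borel_measurable M\<close>
  define F where "F = avg_cdf M X"
  define G where "G = (\<lambda>\<omega>. empirical_cdf (X \<omega>))"
  \<comment> \<open>the least number of quantiles with spacing \<open>1 / (m + 1) \<le> r / 2\<close>; it is \<open>0\<close> for \<open>r \<ge> 2\<close>\<close>
  define m where "m = nat \<lceil>2 / r\<rceil> - 1"
  define e where "e = exp (- (real CARD('n) * r\<^sup>2 / (2 * \<kappa>)))"
  have "2 / r > 0" using \<open>r > 0\<close> by simp
  hence m: "real m \<le> 2 / r" "2 / r \<le> real (m + 1)"
    unfolding m_def by linarith+
  have [measurable]: "(\<lambda>\<omega>. G \<omega> x) \<in> borel_measurable M" for x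
    unfolding G_def by measurable
  have int_G: "integrable M (\<lambda>\<omega>. G \<omega> x)" for x
    by (rule M.integrable_const_bound[where B = 1]) (auto simp: G_def empirical_cdf_bounds)
  have F_eq: "F x = (\<integral>\<omega>. G \<omega> x \<partial>M)" for x
    by (simp add: F_def G_def avg_cdf_def)
  have F_nonneg: "0 \<le> F x" for x
    unfolding F_eq by (simp add: G_def empirical_cdf_bounds)
  have F_le_1: "F x \<le> 1" for x
    unfolding F_eq by (rule M.integral_le_const[OF int_G]) (simp add: G_def empirical_cdf_bounds)
  have "mono F"
    unfolding F_eq
    by (intro monoI integral_mono int_G) (simp add: G_def monoD[OF empirical_cdf_mono])
  have "\<exists>x. F x = real j / real (m + 1)" if "j \<in> {1..m}" for j
  proof -
    have "0 < real j / real (m + 1)" "real j / real (m + 1) < 1"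
      using that by auto
    then show ?thesis
      using continuous_cdf_attains[of F "real j / real (m + 1)"] avg_cdf_limits[OF M.prob_space_axioms X]
        \<open>continuous_on UNIV (avg_cdf M X)\<close> unfolding F_def by metis
  qed
  then obtain q where q: "\<And>j. j \<in> {1..m} \<Longrightarrow> F (q j) = real j / real (m + 1)"
    by metis
  define B where "B = (\<lambda>j. {\<omega> \<in> space M. \<bar>F (q j) - G \<omega> (q j)\<bar> \<ge> r / 2})"
  have B_sets: "B j \<in> sets M" for j
    unfolding B_def by measurable
  have B_prob: "measure M (B j) \<le> 2 * e" for j
  proof -
    have F_\<nu>: "(\<integral>v. empirical_cdf v (q j) \<partial>\<nu>) = F (q j)"
      unfolding \<open>distr M borel X = \<nu>\<close>[symmetric] F_eq G_def by (rule integral_distr) measurable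
    have "measure M (B j) =
        measure \<nu> {v \<in> space \<nu>. \<bar>(\<integral>v. empirical_cdf v (q j) \<partial>\<nu>) - empirical_cdf v (q j)\<bar> \<ge> r / 2}"
      unfolding F_\<nu> unfolding \<open>distr M borel X = \<nu>\<close>[symmetric] B_def G_def
      by (subst measure_distr) (auto simp: vimage_def Int_def conj_commute)
    also have "\<dots> \<le> 2 * exp (- 2 * real CARD('n) * (r / 2)\<^sup>2 / \<kappa>)"
      using assms by (intro empirical_cdf_concentration) auto
    also have "- 2 * real CARD('n) * (r / 2)\<^sup>2 / \<kappa> = - (real CARD('n) * r\<^sup>2 / (2 * \<kappa>))"
      by (simp add: power2_eq_square)
    finally show ?thesis by (simp add: e_def)
  qed
  have "{\<omega> \<in> space M. (SUP x. \<bar>F x - G \<omega> x\<bar>) \<ge> r} \<subseteq> (\<Union>j\<in>{1..m}. B j)"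
  proof
    fix \<omega> assume \<omega>: "\<omega> \<in> {\<omega> \<in> space M. (SUP x. \<bar>F x - G \<omega> x\<bar>) \<ge> r}"
    show "\<omega> \<in> (\<Union>j\<in>{1..m}. B j)"
    proof (rule ccontr)
      assume "\<omega> \<notin> (\<Union>j\<in>{1..m}. B j)"
      hence small: "\<bar>F (q j) - G \<omega> (q j)\<bar> < r / 2" if "j \<in> {1..m}" for j
        using \<omega> that by (force simp: B_def)
      \<comment> \<open>finitely many strict bounds give a common one, which keeps the supremum strictly below \<open>r\<close>\<close>
      define d where "d = Max (insert 0 ((\<lambda>j. \<bar>F (q j) - G \<omega> (q j)\<bar>) ` {1..m}))"
      have d: "0 \<le> d" "d < r / 2" "\<And>j. j \<in> {1..m} \<Longrightarrow> \<bar>F (q j) - G \<omega> (q j)\<bar> \<le> d"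
      proof -
        show "0 \<le> d" unfolding d_def by (rule Max_ge) auto
        show "d < r / 2" unfolding d_def
          using small \<open>r > 0\<close> by (subst Max_less_iff) auto
        show "\<bar>F (q j) - G \<omega> (q j)\<bar> \<le> d" if "j \<in> {1..m}" for j
          unfolding d_def using that by (intro Max_ge) auto
      qed
      have "\<bar>F x - G \<omega> x\<bar> \<le> d + 1 / real (m + 1)" for x
        using \<open>mono F\<close> F_nonneg F_le_1 q d
        by (intro deviation_le_grid[of F _ m q]) (auto simp: G_def empirical_cdf_mono empirical_cdf_bounds)
      hence "(SUP x. \<bar>F x - G \<omega> x\<bar>) \<le> d + 1 / real (m + 1)"
        by (intro cSUP_least) auto
      moreover have "1 / real (m + 1) \<le> r / 2"
        using m(2) \<open>r > 0\<close> by (simp add: field_simps)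
      ultimately show False using \<omega> d(2) by auto
    qed
  qed
  hence "\<P>(\<omega> in M. (SUP x. \<bar>F x - G \<omega> x\<bar>) \<ge> r) \<le> measure M (\<Union>j\<in>{1..m}. B j)"
    using B_sets by (intro M.finite_measure_mono) auto
  also have "\<dots> \<le> (\<Sum>j\<in>{1..m}. measure M (B j))"
    using B_sets by (intro M.finite_measure_subadditive_finite) auto
  also have "\<dots> \<le> (\<Sum>j\<in>{1..m}. 2 * e)"
    by (intro sum_mono B_prob)
  also have "\<dots> = real m * (2 * e)" by simp
  also have "\<dots> \<le> 2 / r * (2 * e)"
    by (intro mult_right_mono m) (simp add: e_def)
  finally show ?thesis
    by (simp add: F_def G_def e_def)
qed

end
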